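(* Let $m$ be a positive integer with $m\equiv0$ mod $4$. There exists a complex model $\mathfrak{C}=(V,\langle\cdot,\cdot\rangle,J,A)$ with $\dim_{\mathbb{R}}V=m$ and $A\neq0$ such that $\mathcal{J}(\pi)=0$ and $\mathcal{A}(\pi)=0$ for every $\pi\in\mathbb{CP}(V,J)$.
   Context: A complex model $(V,\langle\cdot,\cdot\rangle,J,A)$ consists of a finite-dimensional real vector space $V$ with a positive definite inner product $\langle\cdot,\cdot\rangle$, a unitary complex structure $J$ (a linear map with $J^2=-\mathrm{id}$ and $\langle Jx,Jy\rangle=\langle x,y\rangle$), and an algebraic curvature tensor $A\in\otimes^4V^*$, i.e. $A(x,y,z,w)=A(z,w,x,y)=-A(y,x,z,w)$ and $A(x,y,z,w)+A(y,z,x,w)+A(z,x,y,w)=0$. The curvature operator $\mathcal{A}$ is defined by $\langle\mathcal{A}(x,y)z,w\rangle=A(x,y,z,w)$, and the Jacobi operator by $\mathcal{J}(x)y=\mathcal{A}(y,x)x$, i.e. $\langle\mathcal{J}(x)y,z\rangle=A(y,x,x,z)$. $\mathbb{CP}(V,J)$ is the set of complex lines, i.e. real $2$-dimensional subspaces $\pi\subset V$ with $J\pi=\pi$. For such $\pi$ and any unit vector $x\in\pi$, $\mathcal{J}(\pi):=\mathcal{J}(x)+\mathcal{J}(Jx)$ and $\mathcal{A}(\pi):=\mathcal{A}(x,Jx)$; these do not depend on the choice of the unit vector $x$. *)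

theory Defs
  imports "HOL-Analysis.Analysis" "HOL-Analysis.Finite_Function_Topology"
begin

text \<open>
  A model lives on a linear subspace \<open>V\<close> of an ambient real vector space, so that
  dimension and vector space can both be quantified over. All maps are total
  functions on the ambient type; only their restrictions to \<open>V\<close> are meaningful.
\<close>

definition linear_on :: "'v::real_vector set \<Rightarrow> ('v \<Rightarrow> 'w::real_vector) \<Rightarrow> bool" where
  "linear_on V f \<longleftrightarrow>
     (\<forall>x\<in>V. \<forall>y\<in>V. f (x + y) = f x + f y) \<and> (\<forall>c. \<forall>x\<in>V. f (c *\<^sub>R x) = c *\<^sub>R f x)"

definition inner_product_on :: "'v::real_vector set \<Rightarrow> ('v \<Rightarrow> 'v \<Rightarrow> real) \<Rightarrow> bool" where
  "inner_product_on V g \<longleftrightarrow>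
     (\<forall>y\<in>V. linear_on V (\<lambda>x. g x y)) \<and>
     (\<forall>x\<in>V. \<forall>y\<in>V. g x y = g y x) \<and>
     (\<forall>x\<in>V. x \<noteq> 0 \<longrightarrow> g x x > 0)"

definition unitary_complex_structure_on ::
  "'v::real_vector set \<Rightarrow> ('v \<Rightarrow> 'v \<Rightarrow> real) \<Rightarrow> ('v \<Rightarrow> 'v) \<Rightarrow> bool" where
  "unitary_complex_structure_on V g J \<longleftrightarrow>
     (\<forall>x\<in>V. J x \<in> V) \<and> linear_on V J \<and>
     (\<forall>x\<in>V. J (J x) = - x) \<and>
     (\<forall>x\<in>V. \<forall>y\<in>V. g (J x) (J y) = g x y)"

definition multilinear4_on ::
  "'v::real_vector set \<Rightarrow> ('v \<Rightarrow> 'v \<Rightarrow> 'v \<Rightarrow> 'v \<Rightarrow> real) \<Rightarrow> bool" where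
  "multilinear4_on V A \<longleftrightarrow>
     (\<forall>a\<in>V. \<forall>b\<in>V. \<forall>c\<in>V.
        linear_on V (\<lambda>x. A x a b c) \<and> linear_on V (\<lambda>x. A a x b c) \<and>
        linear_on V (\<lambda>x. A a b x c) \<and> linear_on V (\<lambda>x. A a b c x))"

definition algebraic_curvature_tensor_on ::
  "'v::real_vector set \<Rightarrow> ('v \<Rightarrow> 'v \<Rightarrow> 'v \<Rightarrow> 'v \<Rightarrow> real) \<Rightarrow> bool" where
  "algebraic_curvature_tensor_on V A \<longleftrightarrow>
     multilinear4_on V A \<and>
     (\<forall>x\<in>V. \<forall>y\<in>V. \<forall>z\<in>V. \<forall>w\<in>V.
        A x y z w = A z w x y \<and> A x y z w = - A y x z w \<and>
        A x y z w + A y z x w + A z x y w = 0)"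

locale complex_model =
  fixes V :: "'v::real_vector set"
    and g :: "'v \<Rightarrow> 'v \<Rightarrow> real"
    and J :: "'v \<Rightarrow> 'v"
    and A :: "'v \<Rightarrow> 'v \<Rightarrow> 'v \<Rightarrow> 'v \<Rightarrow> real"
  assumes finite_dimensional: "\<exists>B. finite B \<and> span B = V"
    and inner_product: "inner_product_on V g"
    and complex_structure: "unitary_complex_structure_on V g J"
    and curvature_tensor: "algebraic_curvature_tensor_on V A"

definition curvature_operator ::
  "'v::real_vector set \<Rightarrow> ('v \<Rightarrow> 'v \<Rightarrow> real) \<Rightarrow> ('v \<Rightarrow> 'v \<Rightarrow> 'v \<Rightarrow> 'v \<Rightarrow> real) \<Rightarrow>
    'v \<Rightarrow> 'v \<Rightarrow> 'v \<Rightarrow> 'v" where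
  "curvature_operator V g A x y z = (THE u. u \<in> V \<and> (\<forall>w\<in>V. g u w = A x y z w))"

definition jacobi_operator ::
  "'v::real_vector set \<Rightarrow> ('v \<Rightarrow> 'v \<Rightarrow> real) \<Rightarrow> ('v \<Rightarrow> 'v \<Rightarrow> 'v \<Rightarrow> 'v \<Rightarrow> real) \<Rightarrow>
    'v \<Rightarrow> 'v \<Rightarrow> 'v" where
  "jacobi_operator V g A x y = curvature_operator V g A y x x"

definition complex_lines :: "'v::real_vector set \<Rightarrow> ('v \<Rightarrow> 'v) \<Rightarrow> 'v set set" where
  "complex_lines V J = {P. subspace P \<and> P \<subseteq> V \<and> dim P = 2 \<and> J ` P = P}"

definition unit_vector_of :: "('v \<Rightarrow> 'v \<Rightarrow> real) \<Rightarrow> 'v set \<Rightarrow> 'v" where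
  "unit_vector_of g P = (SOME x. x \<in> P \<and> g x x = 1)"

text \<open>
  The choice of unit vector in the next two definitions is immaterial: see
  \<open>complex_jacobi_operator_eq\<close> and \<open>complex_curvature_operator_eq\<close> below.
\<close>

definition complex_jacobi_operator ::
  "'v::real_vector set \<Rightarrow> ('v \<Rightarrow> 'v \<Rightarrow> real) \<Rightarrow> ('v \<Rightarrow> 'v) \<Rightarrow>
    ('v \<Rightarrow> 'v \<Rightarrow> 'v \<Rightarrow> 'v \<Rightarrow> real) \<Rightarrow> 'v set \<Rightarrow> 'v \<Rightarrow> 'v" where
  "complex_jacobi_operator V g J A P y =
     jacobi_operator V g A (unit_vector_of g P) y
     + jacobi_operator V g A (J (unit_vector_of g P)) y"

definition complex_curvature_operator ::
  "'v::real_vector set \<Rightarrow> ('v \<Rightarrow> 'v \<Rightarrow> real) \<Rightarrow> ('v \<Rightarrow> 'v) \<Rightarrow>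
    ('v \<Rightarrow> 'v \<Rightarrow> 'v \<Rightarrow> 'v \<Rightarrow> real) \<Rightarrow> 'v set \<Rightarrow> 'v \<Rightarrow> 'v" where
  "complex_curvature_operator V g J A P z =
     curvature_operator V g A (unit_vector_of g P) (J (unit_vector_of g P)) z"

lemma linear_on_add: "linear_on V f \<Longrightarrow> x \<in> V \<Longrightarrow> y \<in> V \<Longrightarrow> f (x + y) = f x + f y"
  and linear_on_scale: "linear_on V f \<Longrightarrow> x \<in> V \<Longrightarrow> f (c *\<^sub>R x) = c *\<^sub>R f x"
  by (auto simp: linear_on_def)

lemma linear_on_subset: "linear_on V f \<Longrightarrow> W \<subseteq> V \<Longrightarrow> linear_on W f"
  by (auto simp: linear_on_def subset_iff)

context complex_model
begin

lemma subspace_V: "subspace V"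
  using finite_dimensional by auto

lemma V_closed [simp]:
  "0 \<in> V" "x \<in> V \<Longrightarrow> y \<in> V \<Longrightarrow> x + y \<in> V" "x \<in> V \<Longrightarrow> c *\<^sub>R x \<in> V"
  "x \<in> V \<Longrightarrow> - x \<in> V" "x \<in> V \<Longrightarrow> y \<in> V \<Longrightarrow> x - y \<in> V"
  using subspace_V
  by (auto intro: subspace_0 subspace_add subspace_mul subspace_neg subspace_diff)

lemma g_sym: "x \<in> V \<Longrightarrow> y \<in> V \<Longrightarrow> g x y = g y x"
  and g_pos: "x \<in> V \<Longrightarrow> x \<noteq> 0 \<Longrightarrow> g x x > 0"
  using inner_product by (auto simp: inner_product_on_def)

lemma g_add_left: "x \<in> V \<Longrightarrow> x' \<in> V \<Longrightarrow> y \<in> V \<Longrightarrow> g (x + x') y = g x y + g x' y"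
  and g_scale_left: "x \<in> V \<Longrightarrow> y \<in> V \<Longrightarrow> g (c *\<^sub>R x) y = c * g x y"
  using inner_product by (auto simp: inner_product_on_def linear_on_def)

lemma g_diff_left: "x \<in> V \<Longrightarrow> x' \<in> V \<Longrightarrow> y \<in> V \<Longrightarrow> g (x - x') y = g x y - g x' y"
  using g_add_left[of x "(-1) *\<^sub>R x'" y] g_scale_left[of x' y "-1"] by simp

lemma g_add_right: "x \<in> V \<Longrightarrow> x' \<in> V \<Longrightarrow> y \<in> V \<Longrightarrow> g y (x + x') = g y x + g y x'"
  and g_scale_right: "x \<in> V \<Longrightarrow> y \<in> V \<Longrightarrow> g y (c *\<^sub>R x) = c * g y x"
  by (simp_all add: g_sym[of y] g_add_left g_scale_left)

lemma J_closed [simp]: "x \<in> V \<Longrightarrow> J x \<in> V"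
  and J_add: "x \<in> V \<Longrightarrow> y \<in> V \<Longrightarrow> J (x + y) = J x + J y"
  and J_scale: "x \<in> V \<Longrightarrow> J (c *\<^sub>R x) = c *\<^sub>R J x"
  and J_J: "x \<in> V \<Longrightarrow> J (J x) = - x"
  and g_J_J: "x \<in> V \<Longrightarrow> y \<in> V \<Longrightarrow> g (J x) (J y) = g x y"
  using complex_structure by (auto simp: unitary_complex_structure_on_def linear_on_def)

lemma g_J_self: "x \<in> V \<Longrightarrow> g x (J x) = 0"
proof -
  assume x: "x \<in> V"
  have "g x (J x) = g (J x) (J (J x))" using x g_J_J[of x "J x"] by simp
  also have "\<dots> = g (J x) ((-1) *\<^sub>R x)" using x by (simp add: J_J)
  also have "\<dots> = - g (J x) x" using x by (subst g_scale_right) auto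
  finally show ?thesis using x g_sym[of x "J x"] by simp
qed

lemma A_linear:
  assumes "a \<in> V" "b \<in> V" "c \<in> V"
  shows "linear_on V (\<lambda>x. A x a b c)" "linear_on V (\<lambda>x. A a x b c)"
    "linear_on V (\<lambda>x. A a b x c)" "linear_on V (\<lambda>x. A a b c x)"
  using assms curvature_tensor
  by (auto simp: algebraic_curvature_tensor_on_def multilinear4_on_def)

lemma A_antisym: "x \<in> V \<Longrightarrow> y \<in> V \<Longrightarrow> z \<in> V \<Longrightarrow> w \<in> V \<Longrightarrow> A x y z w = - A y x z w"
  using curvature_tensor unfolding algebraic_curvature_tensor_on_def by blast

lemma riesz_unique:
  assumes "u \<in> V" "v \<in> V" "\<And>w. w \<in> V \<Longrightarrow> g u w = g v w"
  shows "u = v"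
proof (rule ccontr)
  assume "u \<noteq> v"
  then have "g (u - v) (u - v) > 0" using assms by (intro g_pos) auto
  moreover have "g (u - v) (u - v) = 0" using assms by (simp add: g_diff_left)
  ultimately show False by simp
qed

lemma riesz_span:
  assumes "finite B" "B \<subseteq> V" "linear_on V f"
  shows "\<exists>u\<in>span B. \<forall>w\<in>span B. g u w = f w"
  using assms
proof (induction B arbitrary: f rule: finite_induct)
  case empty
  have "f 0 = 0" "g 0 0 = 0"
    using linear_on_scale[OF empty(2), of 0 0] g_scale_left[of 0 0 0] by simp_all
  then show ?case by simp
next
  case (insert b B)
  have b: "b \<in> V" and BV: "B \<subseteq> V" using insert.prems by auto
  have sB: "span B \<subseteq> V" using BV subspace_V by (rule span_minimal)
  have lin: "linear_on V (\<lambda>w. g b w)"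
    using b by (auto simp: linear_on_def g_add_right g_scale_right)
  obtain p where p: "p \<in> span B" "\<And>w. w \<in> span B \<Longrightarrow> g p w = g b w"
    using insert.IH[OF BV lin] by blast
  obtain u where u: "u \<in> span B" "\<And>w. w \<in> span B \<Longrightarrow> g u w = f w"
    using insert.IH[OF BV insert.prems(2)] by blast
  define q where "q = b - p"
  have pV: "p \<in> V" and uV: "u \<in> V" using p u sB by auto
  have qV: "q \<in> V" using b pV by (simp add: q_def)
  have q_orth: "g q w = 0" if "w \<in> span B" for w
    using that p b pV sB by (auto simp: q_def g_diff_left)
  have decomp: "\<exists>s\<in>span B. \<exists>t. w = s + t *\<^sub>R q" if "w \<in> span (insert b B)" for w
  proof -
    have "\<exists>t. w - t *\<^sub>R b \<in> span B" using that by (simp add: span_insert)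
    then obtain t where t: "w - t *\<^sub>R b \<in> span B" ..
    have "w = (w - t *\<^sub>R b + t *\<^sub>R p) + t *\<^sub>R q" by (simp add: q_def algebra_simps)
    moreover have "w - t *\<^sub>R b + t *\<^sub>R p \<in> span B"
      using t p(1) by (intro span_add span_scale)
    ultimately show ?thesis by blast
  qed
  have qs: "q \<in> span (insert b B)"
    unfolding q_def using p(1) by (intro span_diff) (auto intro: span_base span_mono[THEN subsetD])
  have us: "u \<in> span (insert b B)" using u(1) by (auto intro: span_mono[THEN subsetD])
  define c where "c = f q / g q q"
  have cq: "c * g q q = f q"
  proof (cases "q = 0")
    case True
    then show ?thesis
      using linear_on_scale[OF insert.prems(2), of q 0] qV g_scale_left[of q q 0] by simp
  next
    case False
    then show ?thesis using g_pos[OF qV] by (simp add: c_def)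
  qed
  have "g (u + c *\<^sub>R q) w = f w" if "w \<in> span (insert b B)" for w
  proof -
    obtain s t where s: "s \<in> span B" and w: "w = s + t *\<^sub>R q" using decomp \<open>w \<in> _\<close> by blast
    have sV: "s \<in> V" using s sB by auto
    have uq: "g u q = 0"
      using q_orth[OF u(1)] g_sym[OF qV uV] by simp
    have "g (u + c *\<^sub>R q) w = f s + t * (c * g q q)"
      using sV uV qV uq s
      by (simp add: w g_add_left g_scale_left g_add_right g_scale_right u(2) q_orth algebra_simps)
    also have "\<dots> = f w"
      using sV qV linear_on_add[OF insert.prems(2), of s "t *\<^sub>R q"]
        linear_on_scale[OF insert.prems(2), of q t]
      by (simp add: cq w)
    finally show ?thesis .
  qed
  moreover have "u + c *\<^sub>R q \<in> span (insert b B)"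
    using us qs by (intro span_add span_scale)
  ultimately show ?case by blast
qed

lemma curvature_operator_ex1:
  assumes "x \<in> V" "y \<in> V" "z \<in> V"
  shows "\<exists>!u. u \<in> V \<and> (\<forall>w\<in>V. g u w = A x y z w)"
proof -
  obtain B where "finite B" "span B = V" using finite_dimensional by blast
  moreover from this have "B \<subseteq> V" using span_superset by blast
  ultimately obtain u where "u \<in> V" "\<forall>w\<in>V. g u w = A x y z w"
    using riesz_span[OF _ _ A_linear(4)[OF assms]] by blast
  then show ?thesis by (intro ex1I[of _ u]) (auto intro: riesz_unique)
qed

lemma curvature_operator_closed [simp]:
    "x \<in> V \<Longrightarrow> y \<in> V \<Longrightarrow> z \<in> V \<Longrightarrow> curvature_operator V g A x y z \<in> V"
  and g_curvature_operator:
    "x \<in> V \<Longrightarrow> y \<in> V \<Longrightarrow> z \<in> V \<Longrightarrow> w \<in> V \<Longrightarrow> g (curvature_operator V g A x y z) w = A x y z w"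
  using theI'[OF curvature_operator_ex1, of x y z] unfolding curvature_operator_def by blast+

lemma unit_vector_of:
  assumes "P \<in> complex_lines V J"
  shows "unit_vector_of g P \<in> P" "g (unit_vector_of g P) (unit_vector_of g P) = 1"
proof -
  have P: "subspace P" "P \<subseteq> V" "dim P = 2" using assms by (auto simp: complex_lines_def)
  have "dim {0::'v} = 0"
    using dim_unique[of "{}" "{0::'v}" 0] by (simp add: independent_empty)
  then have "P \<noteq> {0}" using P(3) by auto
  then obtain v where v: "v \<in> P" "v \<noteq> 0" using subspace_0[OF P(1)] by blast
  have vV: "v \<in> V" using v P by auto
  have pos: "g v v > 0" using g_pos vV v by blast
  define c where "c = 1 / sqrt (g v v)"
  have "c *\<^sub>R v \<in> P" using v P(1) by (simp add: subspace_mul)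
  moreover have "g (c *\<^sub>R v) (c *\<^sub>R v) = 1"
    using pos vV by (simp add: g_scale_left g_scale_right c_def)
  ultimately have "\<exists>x. x \<in> P \<and> g x x = 1" by blast
  from someI_ex[OF this] show "unit_vector_of g P \<in> P"
    "g (unit_vector_of g P) (unit_vector_of g P) = 1"
    by (auto simp: unit_vector_of_def)
qed

lemma complex_line_coordinates:
  assumes P: "P \<in> complex_lines V J" and x: "x \<in> P" "g x x = 1" and y: "y \<in> P" "g y y = 1"
  shows "\<exists>a b. y = a *\<^sub>R x + b *\<^sub>R J x \<and> a\<^sup>2 + b\<^sup>2 = 1"
proof -
  have sub: "subspace P" "P \<subseteq> V" "dim P = 2" "J ` P = P"
    using P by (auto simp: complex_lines_def)
  have xV: "x \<in> V" and JxP: "J x \<in> P" using x sub by auto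
  have x0: "x \<noteq> 0" using x(2) g_scale_left[of x x 0] xV by auto
  have notin: "x \<notin> span {J x}"
  proof
    assume "x \<in> span {J x}"
    then obtain k where "x = k *\<^sub>R J x" by (auto simp: span_singleton)
    then have "g x x = k * g x (J x)" using xV g_scale_right[of "J x" x k] by simp
    then show False using x(2) g_J_self[OF xV] by simp
  qed
  then have ne: "x \<noteq> J x" using span_base[of "J x" "{J x}"] by auto
  have Jx0: "J x \<noteq> 0"
    using g_J_J[OF xV xV] x(2) g_scale_left[of "J x" "J x" 0] xV by auto
  have ind: "independent {x, J x}"
    using notin Jx0 ne by (simp add: independent_insert)
  obtain B where B: "B \<subseteq> P" "independent B" "P \<subseteq> span B" "card B = 2"
    using basis_exists[of P] sub(3) by metis
  have finB: "finite B" using B(4) card.infinite by fastforce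
  have "P \<subseteq> span {x, J x}"
  proof
    fix v assume v: "v \<in> P"
    show "v \<in> span {x, J x}"
    proof (rule ccontr)
      assume nv: "v \<notin> span {x, J x}"
      have ni: "v \<notin> {x, J x}" using nv span_superset[of "{x, J x}"] by (meson subsetD)
      have "independent (insert v {x, J x})"
        using ind nv by (rule independent_insertI[rotated])
      moreover have "insert v {x, J x} \<subseteq> span B" using v x JxP B(3) by auto
      ultimately have "card (insert v {x, J x}) \<le> card B"
        using independent_span_bound[OF finB] by blast
      then show False using ne ni B(4) by simp
    qed
  qed
  then have "y \<in> span {x, J x}" using y by auto
  then obtain a b where ab: "y = a *\<^sub>R x + b *\<^sub>R J x"
    by (auto simp: span_insert span_singleton algebra_simps)
  have "g (J x) x = 0" "g (J x) (J x) = 1"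
    using g_J_self[OF xV] g_sym[of x "J x"] g_J_J[OF xV xV] x xV by auto
  then have "g y y = a\<^sup>2 + b\<^sup>2"
    using xV x(2) g_J_self[OF xV]
    by (simp add: ab g_add_left g_scale_left g_add_right g_scale_right power2_eq_square)
  then show ?thesis using ab y(2) by auto
qed

theorem complex_jacobi_operator_eq:
  assumes P: "P \<in> complex_lines V J" and x: "x \<in> P" "g x x = 1" and y: "y \<in> V"
  shows "complex_jacobi_operator V g J A P y = jacobi_operator V g A x y + jacobi_operator V g A (J x) y"
proof -
  define v where "v = unit_vector_of g P"
  obtain a b where v: "v = a *\<^sub>R x + b *\<^sub>R J x" and ab: "a\<^sup>2 + b\<^sup>2 = 1"
    using complex_line_coordinates[OF P x unit_vector_of[OF P]] unfolding v_def by blast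
  have xV: "x \<in> V" using P x by (auto simp: complex_lines_def)
  have Jv: "J v = a *\<^sub>R J x + (- b) *\<^sub>R x"
    using xV by (simp add: v J_add J_scale J_J)
  have expand: "A y (s *\<^sub>R p + t *\<^sub>R q) (s *\<^sub>R p + t *\<^sub>R q) w =
      s\<^sup>2 * A y p p w + s * t * (A y p q w + A y q p w) + t\<^sup>2 * A y q q w"
    if "p \<in> V" "q \<in> V" "w \<in> V" for p q w s t
  proof -
    note l2 = linear_on_add[OF A_linear(2)] linear_on_scale[OF A_linear(2)]
    note l3 = linear_on_add[OF A_linear(3)] linear_on_scale[OF A_linear(3)]
    show ?thesis using that y by (simp add: l2 l3 power2_eq_square algebra_simps)
  qed
  have sums: "A y v v w + A y (J v) (J v) w = A y x x w + A y (J x) (J x) w" if w: "w \<in> V" for w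
  proof -
    have "A y v v w + A y (J v) (J v) w = (a\<^sup>2 + b\<^sup>2) * (A y x x w + A y (J x) (J x) w)"
      unfolding Jv unfolding v
      using xV w by (simp only: expand J_closed) (simp add: algebra_simps)
    then show ?thesis by (simp add: ab)
  qed
  have vV: "v \<in> V" using xV by (simp add: v)
  show ?thesis
    unfolding complex_jacobi_operator_def jacobi_operator_def v_def[symmetric]
    using xV vV y sums
    by (intro riesz_unique) (simp_all add: g_add_left g_curvature_operator)
qed

theorem complex_curvature_operator_eq:
  assumes P: "P \<in> complex_lines V J" and x: "x \<in> P" "g x x = 1" and z: "z \<in> V"
  shows "complex_curvature_operator V g J A P z = curvature_operator V g A x (J x) z"
proof -
  define v where "v = unit_vector_of g P"
  obtain a b where v: "v = a *\<^sub>R x + b *\<^sub>R J x" and ab: "a\<^sup>2 + b\<^sup>2 = 1"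
    using complex_line_coordinates[OF P x unit_vector_of[OF P]] unfolding v_def by blast
  have xV: "x \<in> V" using P x by (auto simp: complex_lines_def)
  have Jv: "J v = a *\<^sub>R J x + (- b) *\<^sub>R x"
    using xV by (simp add: v J_add J_scale J_J)
  have vV: "v \<in> V" using xV by (simp add: v)
  have "A v (J v) z w = A x (J x) z w" if w: "w \<in> V" for w
  proof -
    note l1 = linear_on_add[OF A_linear(1)] linear_on_scale[OF A_linear(1)]
    note l2 = linear_on_add[OF A_linear(2)] linear_on_scale[OF A_linear(2)]
    have d: "A p p z w = 0" if "p \<in> V" for p
      using A_antisym[of p p z w] that z w by simp
    have n: "A (J x) x z w = - A x (J x) z w"
      using A_antisym[of "J x" x z w] xV z w by simp
    have "A v (J v) z w = (a\<^sup>2 + b\<^sup>2) * A x (J x) z w"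
      unfolding Jv unfolding v
      using xV z w
      by (simp only: l1 l2 V_closed J_closed) (simp add: d n power2_eq_square algebra_simps)
    then show ?thesis by (simp add: ab)
  qed
  then show ?thesis
    unfolding complex_curvature_operator_def v_def[symmetric]
    using xV vV z by (intro riesz_unique) (simp_all add: g_curvature_operator)
qed

end

end

(*
  Identify V with C^(2n), n = m/4, and let omega be the standard complex symplectic form,
  p = Re omega and q(x, y) = p(Jx, y) = -Im omega(x, y). Every alternating form p gives an algebraic curvature tensor
    A_p(x,y,z,w) = p(x,w) p(y,z) - p(x,z) p(y,w) - 2 p(x,y) p(z,w),
  whose Jacobi operator is determined by A_p(y,x,x,z) = -3 p(y,x) p(x,z). As p(Jx,y) = p(x,Jy),
  replacing x by Jx exchanges p and q up to sign, so A_p and A_q have the same complex Jacobi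
  operator and the same complex curvature operator. Hence A_p - A_q has the required property.
*)

theory Submission
  imports Defs
begin

section \<open>Curvature tensors of alternating forms\<close>

text \<open>The coefficient 2 is forced by the first Bianchi identity: for alternating
  \<open>p\<close>, the cyclic sum over \<open>x\<close>, \<open>y\<close>, \<open>z\<close> of the
  first two products is twice that of \<open>p x y * p z w\<close>.\<close>

definition form_curvature :: "('v \<Rightarrow> 'v \<Rightarrow> real) \<Rightarrow> 'v \<Rightarrow> 'v \<Rightarrow> 'v \<Rightarrow> 'v \<Rightarrow> real" where
  "form_curvature p x y z w = p x w * p y z - p x z * p y w - 2 * p x y * p z w"

definition twisted_curvature ::
  "('v \<Rightarrow> 'v) \<Rightarrow> ('v \<Rightarrow> 'v \<Rightarrow> real) \<Rightarrow> 'v \<Rightarrow> 'v \<Rightarrow> 'v \<Rightarrow> 'v \<Rightarrow> real" where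
  "twisted_curvature J p x y z w =
     form_curvature p x y z w - form_curvature (\<lambda>u v. p (J u) v) x y z w"

lemma algebraic_curvature_tensor_on_form_curvature:
  assumes p: "bilinear p" and alt: "\<And>x y. p x y = - p y x"
  shows "algebraic_curvature_tensor_on V (form_curvature p)"
proof -
  note bil = bilinear_ladd[OF p] bilinear_radd[OF p] bilinear_lmul[OF p] bilinear_rmul[OF p]
  have "multilinear4_on V (form_curvature p)"
    by (simp add: multilinear4_on_def linear_on_def form_curvature_def bil algebra_simps)
  moreover have "form_curvature p x y z w = form_curvature p z w x y"
    "form_curvature p x y z w = - form_curvature p y x z w"
    "form_curvature p x y z w + form_curvature p y z x w + form_curvature p z x y w = 0"
    for x y z w
    \<comment> \<open>These instances orient all six pairs of arguments, after which the symmetries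
      are polynomial identities in six real numbers.\<close>
    using alt[of x y] alt[of x z] alt[of x w] alt[of y z] alt[of y w] alt[of z w]
    by (simp_all add: form_curvature_def algebra_simps)
  ultimately show ?thesis
    unfolding algebraic_curvature_tensor_on_def by blast
qed

text \<open>All conditions on a curvature tensor are linear in the tensor.\<close>

lemma algebraic_curvature_tensor_on_diff:
  assumes "algebraic_curvature_tensor_on V A" "algebraic_curvature_tensor_on V B"
  shows "algebraic_curvature_tensor_on V (\<lambda>x y z w. A x y z w - B x y z w)"
proof -
  have "linear_on V (\<lambda>x. f x - h x)" if "linear_on V f" "linear_on V h" for f h :: "'a \<Rightarrow> real"
    using that by (simp add: linear_on_def algebra_simps)
  then have "multilinear4_on V (\<lambda>x y z w. A x y z w - B x y z w)"
    using assms by (simp add: algebraic_curvature_tensor_on_def multilinear4_on_def)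
  moreover have "A x y z w - B x y z w = A z w x y - B z w x y \<and>
      A x y z w - B x y z w = - (A y x z w - B y x z w) \<and>
      A x y z w - B x y z w + (A y z x w - B y z x w) + (A z x y w - B z x y w) = 0"
    if "x \<in> V" "y \<in> V" "z \<in> V" "w \<in> V" for x y z w
  proof -
    have "C x y z w = C z w x y" "C x y z w = - C y x z w" "C x y z w + C y z x w + C z x y w = 0"
      if "algebraic_curvature_tensor_on V C" for C
      using that \<open>x \<in> V\<close> \<open>y \<in> V\<close> \<open>z \<in> V\<close> \<open>w \<in> V\<close>
      unfolding algebraic_curvature_tensor_on_def by blast+
    from this[OF assms(1)] this[OF assms(2)] show ?thesis by linarith
  qed
  ultimately show ?thesis
    unfolding algebraic_curvature_tensor_on_def by blast
qed

lemma bilinear_compose_left: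
  assumes p: "bilinear p" and J: "linear J"
  shows "bilinear (\<lambda>x y. p (J x) y)"
  using p linear_compose[OF J, of "\<lambda>u. p u y" for y]
  by (auto simp: bilinear_def o_def)

text \<open>The assumptions say that \<open>p\<close> is the real part of the alternating complex
  bilinear form omega(x, y) = p(x, y) - i p(Jx, y), where \<open>J\<close> acts as multiplication by
  i.\<close>

context
  fixes J :: "'v::real_vector \<Rightarrow> 'v" and p :: "'v \<Rightarrow> 'v \<Rightarrow> real"
  assumes J: "linear J" "\<And>x. J (J x) = - x"
    and p: "bilinear p" "\<And>x y. p x y = - p y x" "\<And>x y. p x (J y) = p (J x) y"
begin

lemma twisted_form_alternating: "p (J x) y = - p (J y) x"
  using p(2)[of "J x" y] p(3)[of y x] by simp

lemma algebraic_curvature_tensor_on_twisted_curvature: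
  "algebraic_curvature_tensor_on V (twisted_curvature J p)"
proof -
  have "algebraic_curvature_tensor_on V (form_curvature p)"
    "algebraic_curvature_tensor_on V (form_curvature (\<lambda>x y. p (J x) y))"
    by (intro algebraic_curvature_tensor_on_form_curvature p bilinear_compose_left J
        twisted_form_alternating)+
  from algebraic_curvature_tensor_on_diff[OF this] show ?thesis
    by (simp add: twisted_curvature_def[abs_def])
qed

lemma form_diagonal: "p x x = 0" "p (J x) x = 0"
  using p(2)[of x x] twisted_form_alternating[of x x] by simp_all

lemma form_J_J: "p (J (J x)) y = - p x y"
  by (simp add: J(2) bilinear_lneg[OF p(1)])

text \<open>With q(x, y) = p(Jx, y), the four terms cancel crosswise: A_p(y,Jx,Jx,w) = A_q(y,x,x,w),
  and A_q(y,Jx,Jx,w) = A_p(y,x,x,w) because the sign of J(Jx) = -x enters twice.\<close>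

lemma twisted_curvature_jacobi:
  "twisted_curvature J p y x x w + twisted_curvature J p y (J x) (J x) w = 0"
  by (simp add: twisted_curvature_def form_curvature_def p(3) form_diagonal form_J_J)

text \<open>Both p(x, Jx) and q(x, Jx) vanish, which removes the products with coefficient 2.
  Passing from p to q interchanges the two remaining products.\<close>

lemma twisted_curvature_complex_line: "twisted_curvature J p x (J x) z w = 0"
  by (simp add: twisted_curvature_def form_curvature_def p(3) form_diagonal form_J_J)

theorem complex_model_twisted_curvature:
  assumes V: "\<exists>B. finite B \<and> span B = V" and g: "inner_product_on V g"
    and unitary: "unitary_complex_structure_on V g J"
  shows "complex_model V g J (twisted_curvature J p)"
    and "P \<in> complex_lines V J \<Longrightarrow> y \<in> V \<Longrightarrow>
      complex_jacobi_operator V g J (twisted_curvature J p) P y = 0"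
    and "P \<in> complex_lines V J \<Longrightarrow> y \<in> V \<Longrightarrow>
      complex_curvature_operator V g J (twisted_curvature J p) P y = 0"
proof -
  show M: "complex_model V g J (twisted_curvature J p)"
    using V g unitary algebraic_curvature_tensor_on_twisted_curvature
    by (rule complex_model.intro)
  then interpret complex_model V g J "twisted_curvature J p" .
  \<comment> \<open>The operators are defined by duality, so they are shown to be zero by comparing
    their pairings against each \<open>w\<close> in \<open>V\<close> with those of the zero
    vector.\<close>
  have g0: "g 0 w = 0" if "w \<in> V" for w
    using g_scale_left[of 0 w 0] that by simp
  assume P: "P \<in> complex_lines V J" and y: "y \<in> V"
  have uV: "unit_vector_of g P \<in> V"
    using unit_vector_of(1)[OF P] P by (auto simp: complex_lines_def)
  show "complex_jacobi_operator V g J (twisted_curvature J p) P y = 0"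
    unfolding complex_jacobi_operator_def jacobi_operator_def
    using uV y
    by (intro riesz_unique)
      (simp_all add: g_add_left g_curvature_operator g0 twisted_curvature_jacobi)
  show "complex_curvature_operator V g J (twisted_curvature J p) P y = 0"
    unfolding complex_curvature_operator_def
    using uV y
    by (intro riesz_unique)
      (simp_all add: g_curvature_operator g0 twisted_curvature_complex_line)
qed

end

section \<open>Coordinate subspaces of finitely supported functions\<close>

lemma lookup_scaleR [simp]:
  "Poly_Mapping.lookup (c *\<^sub>R x) i = c *\<^sub>R Poly_Mapping.lookup x i"
  by (simp add: scaleR_poly_mapping_def)

lemma poly_mapping_eq_sum_single:
  assumes "finite I" "Poly_Mapping.keys x \<subseteq> I"
  shows "x = (\<Sum>i\<in>I. Poly_Mapping.lookup x i *\<^sub>R Poly_Mapping.single i (1::real))"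
proof (rule poly_mapping_eqI)
  fix j
  have "Poly_Mapping.lookup (\<Sum>i\<in>I. Poly_Mapping.lookup x i *\<^sub>R Poly_Mapping.single i (1::real)) j =
      (\<Sum>i\<in>I. if i = j then Poly_Mapping.lookup x j else 0)"
    by (auto simp: lookup_sum lookup_single when_def intro!: sum.cong)
  also have "\<dots> = Poly_Mapping.lookup x j"
    using assms by (auto simp: in_keys_iff)
  finally show "Poly_Mapping.lookup x j = Poly_Mapping.lookup
      (\<Sum>i\<in>I. Poly_Mapping.lookup x i *\<^sub>R Poly_Mapping.single i (1::real)) j" ..
qed

text \<open>One ambient type thus contains coordinate subspaces of every finite dimension; the
  finite spanning set also serves to compute \<open>dim\<close>.\<close>

lemma keys_subset_eq_span_single:
  assumes "finite I"
  shows "{x. Poly_Mapping.keys x \<subseteq> I} = span ((\<lambda>i. Poly_Mapping.single i (1::real)) ` I)"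
proof (intro equalityI subsetI)
  fix x assume "x \<in> {x :: 'a \<Rightarrow>\<^sub>0 real. Poly_Mapping.keys x \<subseteq> I}"
  then have "x = (\<Sum>i\<in>I. Poly_Mapping.lookup x i *\<^sub>R Poly_Mapping.single i 1)"
    using poly_mapping_eq_sum_single[OF assms] by blast
  also have "\<dots> \<in> span ((\<lambda>i. Poly_Mapping.single i 1) ` I)"
    by (intro span_sum span_scale span_base) auto
  finally show "x \<in> span ((\<lambda>i. Poly_Mapping.single i 1) ` I)" .
next
  have "subspace {x :: 'a \<Rightarrow>\<^sub>0 real. Poly_Mapping.keys x \<subseteq> I}"
    by (auto simp: subspace_def subset_iff in_keys_iff lookup_add) (metis add.right_neutral)
  moreover have "(\<lambda>i. Poly_Mapping.single i (1::real)) ` I \<subseteq> {x. Poly_Mapping.keys x \<subseteq> I}"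
    by auto
  ultimately show "x \<in> {x. Poly_Mapping.keys x \<subseteq> I}"
    if "x \<in> span ((\<lambda>i. Poly_Mapping.single i (1::real)) ` I)" for x
    using that span_minimal by blast
qed

lemma dim_keys_subset:
  assumes "finite I"
  shows "dim {x :: 'a \<Rightarrow>\<^sub>0 real. Poly_Mapping.keys x \<subseteq> I} = card I"
proof -
  let ?e = "\<lambda>i::'a. Poly_Mapping.single i (1::real)"
  have inj: "inj_on ?e I"
    by (rule inj_onI) (metis lookup_single_eq lookup_single_not_eq zero_neq_one)
  have "independent (?e ` I)"
  proof (rule independent_if_scalars_zero)
    fix f v assume "(\<Sum>v\<in>?e ` I. f v *\<^sub>R v) = 0" and "v \<in> ?e ` I"
    then obtain i where i: "i \<in> I" "v = ?e i" and "(\<Sum>j\<in>I. f (?e j) *\<^sub>R ?e j) = 0"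
      by (auto simp: sum.reindex[OF inj])
    then have "0 = Poly_Mapping.lookup (\<Sum>j\<in>I. f (?e j) *\<^sub>R ?e j) i" by simp
    also have "\<dots> = (\<Sum>j\<in>I. if j = i then f (?e i) else 0)"
      by (auto simp: lookup_sum lookup_single when_def intro!: sum.cong)
    also have "\<dots> = f v" using assms i by simp
    finally show "f v = 0" ..
  qed (use assms in simp)
  then show ?thesis
    unfolding keys_subset_eq_span_single[OF assms]
    by (simp add: dim_eq_card_independent card_image[OF inj])
qed

section \<open>The complex symplectic model\<close>

text \<open>
  The coordinates \<open>4 * k, \<dots>, 4 * k + 3\<close> are the real and imaginary parts of the two complex
  coordinates of the \<open>k\<close>-th symplectic plane.
\<close>

lift_definition std_complex_structure :: "(nat \<Rightarrow>\<^sub>0 real) \<Rightarrow> (nat \<Rightarrow>\<^sub>0 real)" is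
  "\<lambda>x i. if even i then - x (Suc i) else x (i - 1)"
proof -
  fix x :: "nat \<Rightarrow> real"
  assume fin: "finite {i. x i \<noteq> 0}"
  \<comment> \<open>An even index of the new support lies just below an index of the old one, an odd
    index just above.\<close>
  have "{i. (if even i then - x (Suc i) else x (i - 1)) \<noteq> 0} \<subseteq>
      (\<lambda>i. i - 1) ` {i. x i \<noteq> 0} \<union> Suc ` {i. x i \<noteq> 0}"
    by (force simp: image_iff elim: oddE split: if_splits)
  then show "finite {i. (if even i then - x (Suc i) else x (i - 1)) \<noteq> 0}"
    by (rule finite_subset) (use fin in simp)
qed

definition std_inner :: "nat \<Rightarrow> (nat \<Rightarrow>\<^sub>0 real) \<Rightarrow> (nat \<Rightarrow>\<^sub>0 real) \<Rightarrow> real" where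
  "std_inner n x y = (\<Sum>k<n.
     Poly_Mapping.lookup x (4 * k) * Poly_Mapping.lookup y (4 * k) + Poly_Mapping.lookup x (4 * k + 1) * Poly_Mapping.lookup y (4 * k + 1) +
     Poly_Mapping.lookup x (4 * k + 2) * Poly_Mapping.lookup y (4 * k + 2) + Poly_Mapping.lookup x (4 * k + 3) * Poly_Mapping.lookup y (4 * k + 3))"

text \<open>With u_k = x(4k) + i x(4k+1) and v_k = x(4k+2) + i x(4k+3), and u'_k, v'_k likewise for
  \<open>y\<close>, this is the real part of the sum of u_k v'_k - v_k u'_k.\<close>

definition re_symplectic :: "nat \<Rightarrow> (nat \<Rightarrow>\<^sub>0 real) \<Rightarrow> (nat \<Rightarrow>\<^sub>0 real) \<Rightarrow> real" where
  "re_symplectic n x y = (\<Sum>k<n.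
     Poly_Mapping.lookup x (4 * k) * Poly_Mapping.lookup y (4 * k + 2) - Poly_Mapping.lookup x (4 * k + 1) * Poly_Mapping.lookup y (4 * k + 3) -
     Poly_Mapping.lookup x (4 * k + 2) * Poly_Mapping.lookup y (4 * k) + Poly_Mapping.lookup x (4 * k + 3) * Poly_Mapping.lookup y (4 * k + 1))"

lemma lookup_std_complex_structure [simp]:
  "Poly_Mapping.lookup (std_complex_structure x) (4 * k) = - Poly_Mapping.lookup x (4 * k + 1)"
  "Poly_Mapping.lookup (std_complex_structure x) (4 * k + 1) = Poly_Mapping.lookup x (4 * k)"
  "Poly_Mapping.lookup (std_complex_structure x) (4 * k + 2) = - Poly_Mapping.lookup x (4 * k + 3)"
  "Poly_Mapping.lookup (std_complex_structure x) (4 * k + 3) = Poly_Mapping.lookup x (4 * k + 2)"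
  by (simp_all add: std_complex_structure.rep_eq numeral_3_eq_3)

lemma linear_std_complex_structure: "linear std_complex_structure"
  by (rule linearI) (auto intro!: poly_mapping_eqI simp: std_complex_structure.rep_eq lookup_add)

lemma std_complex_structure_square:
  "std_complex_structure (std_complex_structure x) = - x"
  by (rule poly_mapping_eqI) (auto simp: std_complex_structure.rep_eq)

lemma std_inner_std_complex_structure:
  "std_inner n (std_complex_structure x) (std_complex_structure y) = std_inner n x y"
  unfolding std_inner_def lookup_std_complex_structure by (simp add: algebra_simps)

lemma bilinear_re_symplectic: "bilinear (re_symplectic n)"
  by (auto simp: bilinear_def re_symplectic_def lookup_add algebra_simps sum.distrib
      sum_subtractf sum_distrib_left intro!: linearI)

lemma re_symplectic_alternating: "re_symplectic n x y = - re_symplectic n y x"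
  by (simp add: re_symplectic_def sum_negf[symmetric] algebra_simps)

text \<open>The symplectic form is complex bilinear, so a factor i may be moved from one argument to
  the other.\<close>

lemma re_symplectic_std_complex_structure:
  "re_symplectic n x (std_complex_structure y) = re_symplectic n (std_complex_structure x) y"
  unfolding re_symplectic_def lookup_std_complex_structure by (simp add: algebra_simps)

lemma inner_product_on_std_inner:
  "inner_product_on {x. Poly_Mapping.keys x \<subseteq> {..<4 * n}} (std_inner n)"
proof -
  have "std_inner n x x > 0" if x: "Poly_Mapping.keys x \<subseteq> {..<4 * n}" "x \<noteq> 0" for x
  proof -
    obtain i where "i \<in> Poly_Mapping.keys x" using x(2) by fastforce
    then have i: "Poly_Mapping.lookup x i \<noteq> 0" "i < 4 * n" using x(1) by (auto simp: in_keys_iff)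
    \<comment> \<open>The inner square of \<open>x\<close> is a sum of nonnegative blocks
      \<open>f k\<close>; the block \<open>i div 4\<close>, which contains the nonzero coordinate
      \<open>i\<close>, is positive.\<close>
    define f where "f k = Poly_Mapping.lookup x (4 * k) ^ 2 + Poly_Mapping.lookup x (4 * k + 1) ^ 2 +
      Poly_Mapping.lookup x (4 * k + 2) ^ 2 + Poly_Mapping.lookup x (4 * k + 3) ^ 2" for k
    have "i mod 4 = 0 \<or> i mod 4 = 1 \<or> i mod 4 = 2 \<or> i mod 4 = 3" by linarith
    then have "i \<in> {4 * (i div 4), 4 * (i div 4) + 1, 4 * (i div 4) + 2, 4 * (i div 4) + 3}"
      using mult_div_mod_eq[of 4 i] by auto
    then have "f (i div 4) > 0"
      using i(1) unfolding f_def
      by (smt (verit) insert_iff empty_iff zero_le_power2 zero_less_power2)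
    moreover have "f k \<ge> 0" for k by (simp add: f_def)
    moreover have "i div 4 < n" using i(2) by auto
    ultimately have "(\<Sum>k<n. f k) > 0" by (intro sum_pos2[of _ "i div 4"]) auto
    then show ?thesis by (simp add: std_inner_def f_def power2_eq_square)
  qed
  then show ?thesis
    by (simp add: inner_product_on_def linear_on_def std_inner_def lookup_add algebra_simps
        sum.distrib sum_distrib_left)
qed

lemma unitary_std_complex_structure:
  "unitary_complex_structure_on {x. Poly_Mapping.keys x \<subseteq> {..<4 * n}}
     (std_inner n) std_complex_structure"
proof -
  have "Poly_Mapping.keys (std_complex_structure x) \<subseteq> {..<4 * n}"
    if x: "Poly_Mapping.keys x \<subseteq> {..<4 * n}" for x
  proof
    fix i assume "i \<in> Poly_Mapping.keys (std_complex_structure x)"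
    then have "if even i then Suc i \<in> Poly_Mapping.keys x else i - 1 \<in> Poly_Mapping.keys x"
      by (auto simp: in_keys_iff std_complex_structure.rep_eq split: if_splits)
    then have "if even i then Suc i < 4 * n else i - 1 < 4 * n"
      using x by (auto split: if_splits)
    \<comment> \<open>For odd \<open>i\<close> the bound on \<open>i - 1\<close> suffices because
      \<open>i - 1\<close> and \<open>4 * n\<close> are both even.\<close>
    then show "i \<in> {..<4 * n}" by (auto split: if_splits) presburger+
  qed
  then show ?thesis
    using linear_std_complex_structure
    by (simp add: unitary_complex_structure_on_def linear_on_def std_complex_structure_square
        std_inner_std_complex_structure linear_add linear_scale)
qed

text \<open>The vectors \<open>e 0\<close> and \<open>e 2\<close> are a complex symplectic basis of
  the first plane, with omega(e 0, e 2) = 1. Hence p = 1 and q = 0 on this pair, so A_p contributes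
  3 and A_q contributes 0.\<close>

lemma twisted_curvature_re_symplectic_nonzero:
  assumes "n > 0"
  defines "e \<equiv> \<lambda>i. Poly_Mapping.single i 1"
  shows "twisted_curvature std_complex_structure (re_symplectic n) (e 0) (e 2) (e 2) (e 0) \<noteq> 0"
proof -
  have single: "Poly_Mapping.lookup (e i) j = (if j = i then 1 else 0)" for i j
    by (simp add: e_def lookup_single when_def)
  \<comment> \<open>Writing \<open>n\<close> as a successor splits off the block
    \<open>k = 0\<close>, the only one in which \<open>e 0\<close> and \<open>e 2\<close> have
    nonzero coordinates.\<close>
  obtain n' where n': "n = Suc n'" using assms(1) gr0_conv_Suc by blast
  have "re_symplectic n (e 0) (e 2) = 1"
    unfolding re_symplectic_def n' sum.lessThan_Suc_shift by (simp add: single)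
  moreover have "re_symplectic n (std_complex_structure (e 0)) (e 2) = 0"
    unfolding re_symplectic_def n' sum.lessThan_Suc_shift lookup_std_complex_structure
    by (simp add: single)
  moreover have "re_symplectic n (e 2) (e 0) = - re_symplectic n (e 0) (e 2)"
    "re_symplectic n (std_complex_structure (e 2)) (e 0) =
      - re_symplectic n (std_complex_structure (e 0)) (e 2)"
    using re_symplectic_alternating[of n "e 2" "e 0"]
      re_symplectic_alternating[of n "std_complex_structure (e 2)" "e 0"]
      re_symplectic_std_complex_structure[of n "e 0" "e 2"] by simp_all
  moreover have "re_symplectic n (e i) (e i) = 0"
    "re_symplectic n (std_complex_structure (e i)) (e i) = 0" for i
    using re_symplectic_alternating[of n "e i" "e i"]
      re_symplectic_alternating[of n "std_complex_structure (e i)" "e i"]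
      re_symplectic_std_complex_structure[of n "e i" "e i"] by simp_all
  ultimately show ?thesis
    by (simp add: twisted_curvature_def form_curvature_def)
qed

theorem theorem1p5:
  fixes m :: nat
  assumes "m > 0" and "m mod 4 = 0"
  shows "\<exists>(V :: (nat \<Rightarrow>\<^sub>0 real) set) g J A.
    complex_model V g J A \<and> dim V = m \<and>
    (\<exists>x\<in>V. \<exists>y\<in>V. \<exists>z\<in>V. \<exists>w\<in>V. A x y z w \<noteq> 0) \<and>
    (\<forall>P\<in>complex_lines V J.
       (\<forall>y\<in>V. complex_jacobi_operator V g J A P y = 0) \<and>
       (\<forall>z\<in>V. complex_curvature_operator V g J A P z = 0))"
proof -
  obtain n where m: "m = 4 * n" and n: "n > 0" using assms by (auto elim: dvdE)
  \<comment> \<open>This is the real form of C^(2n): \<open>n\<close> symplectic planes with four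
    real coordinates each, which is where divisibility of \<open>m\<close> by 4 enters.\<close>
  define V :: "(nat \<Rightarrow>\<^sub>0 real) set" where "V = {x. Poly_Mapping.keys x \<subseteq> {..<4 * n}}"
  let ?A = "twisted_curvature std_complex_structure (re_symplectic n)"
  have fin: "\<exists>B. finite B \<and> span B = V"
    using keys_subset_eq_span_single[of "{..<4 * n}"] unfolding V_def
    by (intro exI[of _ "(\<lambda>i. Poly_Mapping.single i 1) ` {..<4 * n}"]) simp
  note model = complex_model_twisted_curvature[OF linear_std_complex_structure
      std_complex_structure_square bilinear_re_symplectic re_symplectic_alternating
      re_symplectic_std_complex_structure fin
      inner_product_on_std_inner[of n, folded V_def]
      unitary_std_complex_structure[of n, folded V_def]]
  have "Poly_Mapping.single 0 1 \<in> V" "Poly_Mapping.single 2 1 \<in> V"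
    using n by (auto simp: V_def)
  then have "\<exists>x\<in>V. \<exists>y\<in>V. \<exists>z\<in>V. \<exists>w\<in>V. ?A x y z w \<noteq> 0"
    using twisted_curvature_re_symplectic_nonzero[OF n] by blast
  moreover have "dim V = m"
    by (simp add: V_def m dim_keys_subset)
  ultimately show ?thesis
    using model by blast
qed

end
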